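(* Let $G$ be a group and $x\in G$ such that the conjugacy class $x^G$ generates $G$. Let $T$ be a 1-tangle diagram with arcs $0,1,\dots,n$ (initial arc $0$, terminal arc $n$), let $Q=x^G$ be the conjugation quandle, let $C\in \mathrm{Col}_Q^x(T)$, and let $\bar{C}$ be the unique lifting of the coloring $C$ to $\mathrm{Col}^1_{\mathrm{GAlex}(G',f_x)}(T)$. Then $\bar{C}(n)=\mathcal{L}(C)$.
   Context: A quandle is a set with binary operation $*$ such that every element is idempotent and every right translation $R_a(y)=y*a$ is an automorphism; write $y\,\bar*\,a=R_a^{-1}(y)$, $*^{1}=*$, $*^{-1}=\bar*$. $x^G$ is a quandle under $a*b=b^{-1}ab$. $G'$ is the commutator subgroup of $G$, $f_x(g)=x^{-1}gx$ restricted to $G'$. $\mathrm{GAlex}(G',f_x)$ is the generalized Alexander quandle: the set $G'$ with $g*h=f_x(gh^{-1})h$. The map $\mathrm{GAlex}(G',f_x)\to x^G$, $g\mapsto g^{-1}xg$, is a quandle covering (an epimorphism $f$ such that $f(y)=f(z)$ implies $a*y=a*z$ for all $a$), sending $1$ to $x$. Wirtinger code: the arcs of the oriented 1-tangle (long knot) diagram $T$ are numbered $0,\dots,n$ in order along the tangle; at the end of arc $i-1$ one undercrosses arc $\kappa(i)$ and continues on arc $i$; $\epsilon(i)\in\{\pm1\}$ is the sign of that crossing; $w(T)=\sum_{i=1}^n\epsilon(i)$. A coloring of $T$ by a quandle $X$ is a map $C:\{0,\dots,n\}\to X$ with $C(i)=C(i-1)*^{\epsilon(i)}C(\kappa(i))$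 for $i=1,\dots,n$. $\mathrm{Col}_X^{e}(T)$ is the set of colorings with $C(0)=e$. For a covering $p:\tilde X\to X$ with $p(\tilde e)=e$, the map $\tilde C\mapsto p\circ\tilde C$ is a bijection $\mathrm{Col}_{\tilde X}^{\tilde e}(T)\to \mathrm{Col}_X^{e}(T)$; the inverse image of $C$ is called its unique lifting. The longitudinal mapping is $\mathcal{L}(C)=x^{-w(T)}C(\kappa(1))^{\epsilon(1)}\cdots C(\kappa(n))^{\epsilon(n)}$, for $C\in\mathrm{Col}_{x^G}^x(T)$. *)

theory Defs
  imports "HOL-Algebra.Generated_Groups"
begin

section \<open>Quandles and quandle coverings\<close>

record 'a magma = "'a partial_object" +
  qop :: "'a \<Rightarrow> 'a \<Rightarrow> 'a"  (infixl \<open>\<triangleleft>\<index>\<close> 70)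

definition quandle_hom :: "('a, 'c) magma_scheme \<Rightarrow> ('b, 'd) magma_scheme \<Rightarrow> ('a \<Rightarrow> 'b) set" where
  "quandle_hom X Y = {f \<in> carrier X \<rightarrow> carrier Y.
     \<forall>y\<in>carrier X. \<forall>z\<in>carrier X. f (y \<triangleleft>\<^bsub>X\<^esub> z) = f y \<triangleleft>\<^bsub>Y\<^esub> f z}"

definition quandle_aut :: "('a, 'c) magma_scheme \<Rightarrow> ('a \<Rightarrow> 'a) set" where
  "quandle_aut X = {f \<in> quandle_hom X X. bij_betw f (carrier X) (carrier X)}"

definition quandle :: "('a, 'c) magma_scheme \<Rightarrow> bool" where
  "quandle X \<longleftrightarrow> (\<forall>a\<in>carrier X. a \<triangleleft>\<^bsub>X\<^esub> a = a \<and> (\<lambda>y. y \<triangleleft>\<^bsub>X\<^esub> a) \<in> quandle_aut X)"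

definition qop_bar :: "('a, 'c) magma_scheme \<Rightarrow> 'a \<Rightarrow> 'a \<Rightarrow> 'a" where
  "qop_bar X y a = inv_into (carrier X) (\<lambda>z. z \<triangleleft>\<^bsub>X\<^esub> a) y"

text \<open>Only the exponents \<open>1\<close> and \<open>-1\<close> are meaningful.\<close>

definition qop_sgn :: "('a, 'c) magma_scheme \<Rightarrow> int \<Rightarrow> 'a \<Rightarrow> 'a \<Rightarrow> 'a" where
  "qop_sgn X s y a = (if s = 1 then y \<triangleleft>\<^bsub>X\<^esub> a else qop_bar X y a)"

definition quandle_covering ::
    "('a, 'c) magma_scheme \<Rightarrow> ('b, 'd) magma_scheme \<Rightarrow> ('a \<Rightarrow> 'b) \<Rightarrow> bool" where
  "quandle_covering X Y p \<longleftrightarrow> quandle X \<and> quandle Y \<and>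
     p \<in> quandle_hom X Y \<and> p ` carrier X = carrier Y \<and>
     (\<forall>a\<in>carrier X. \<forall>y\<in>carrier X. \<forall>z\<in>carrier X.
        p y = p z \<longrightarrow> a \<triangleleft>\<^bsub>X\<^esub> y = a \<triangleleft>\<^bsub>X\<^esub> z)"


section \<open>Tangle diagrams and their colorings\<close>

text \<open>
  An oriented 1-tangle diagram is represented by its Wirtinger code, the only data of the diagram
  on which colorings and longitudes depend: the index of the terminal arc, and, for each
  undercrossing \<open>i \<in> {1..n}\<close> leading from arc \<open>i - 1\<close> to arc \<open>i\<close>, the overcrossing
  arc and the crossing sign.  Every well-formed code is admitted; planarity of the underlying
  diagram is not required.
\<close>

record tangle =
  last_arc :: nat
  over_arc :: "nat \<Rightarrow> nat"
  crossing_sign :: "nat \<Rightarrow> int"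

definition wirtinger_code :: "tangle \<Rightarrow> bool" where
  "wirtinger_code T \<longleftrightarrow>
     (\<forall>i\<in>{1..last_arc T}. over_arc T i \<in> {0..last_arc T} \<and> crossing_sign T i \<in> {1, -1})"

definition writhe :: "tangle \<Rightarrow> int" where
  "writhe T = (\<Sum>i = 1..last_arc T. crossing_sign T i)"

definition colorings :: "('a, 'c) magma_scheme \<Rightarrow> 'a \<Rightarrow> tangle \<Rightarrow> (nat \<Rightarrow> 'a) set" where
  "colorings X e T = {C \<in> {0..last_arc T} \<rightarrow>\<^sub>E carrier X. C 0 = e \<and>
     (\<forall>i\<in>{1..last_arc T}.
        C i = qop_sgn X (crossing_sign T i) (C (i - 1)) (C (over_arc T i)))}"

text \<open>
  Colorings are extensional on the set of arcs, so that composition with a covering really is a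
  bijection between sets of based colorings (shown below).
\<close>

definition lifting ::
    "('a, 'c) magma_scheme \<Rightarrow> ('a \<Rightarrow> 'b) \<Rightarrow> 'a \<Rightarrow> tangle \<Rightarrow> (nat \<Rightarrow> 'b) \<Rightarrow> (nat \<Rightarrow> 'a)" where
  "lifting X p e T C = (THE D. D \<in> colorings X e T \<and> compose {0..last_arc T} p D = C)"


section \<open>Conjugation and generalized Alexander quandles\<close>

definition conj_class :: "('a, 'c) monoid_scheme \<Rightarrow> 'a \<Rightarrow> 'a set" where
  "conj_class G x = {inv\<^bsub>G\<^esub> g \<otimes>\<^bsub>G\<^esub> x \<otimes>\<^bsub>G\<^esub> g |g. g \<in> carrier G}"

definition conj_quandle :: "('a, 'c) monoid_scheme \<Rightarrow> 'a \<Rightarrow> 'a magma" where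
  "conj_quandle G x =
     \<lparr>carrier = conj_class G x, qop = (\<lambda>a b. inv\<^bsub>G\<^esub> b \<otimes>\<^bsub>G\<^esub> a \<otimes>\<^bsub>G\<^esub> b)\<rparr>"

definition GAlex :: "('a, 'c) monoid_scheme \<Rightarrow> ('a \<Rightarrow> 'a) \<Rightarrow> 'a magma" where
  "GAlex H f =
     \<lparr>carrier = carrier H, qop = (\<lambda>g h. f (g \<otimes>\<^bsub>H\<^esub> inv\<^bsub>H\<^esub> h) \<otimes>\<^bsub>H\<^esub> h)\<rparr>"

definition commutator_subgroup :: "('a, 'c) monoid_scheme \<Rightarrow> ('a, 'c) monoid_scheme" where
  "commutator_subgroup G = G\<lparr>carrier := derived G (carrier G)\<rparr>"

definition conj_aut :: "('a, 'c) monoid_scheme \<Rightarrow> 'a \<Rightarrow> 'a \<Rightarrow> 'a" where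
  "conj_aut G x = (\<lambda>g\<in>derived G (carrier G). inv\<^bsub>G\<^esub> x \<otimes>\<^bsub>G\<^esub> g \<otimes>\<^bsub>G\<^esub> x)"

definition galex_proj :: "('a, 'c) monoid_scheme \<Rightarrow> 'a \<Rightarrow> 'a \<Rightarrow> 'a" where
  "galex_proj G x = (\<lambda>g\<in>derived G (carrier G). inv\<^bsub>G\<^esub> g \<otimes>\<^bsub>G\<^esub> x \<otimes>\<^bsub>G\<^esub> g)"

definition longitudinal :: "('a, 'c) monoid_scheme \<Rightarrow> 'a \<Rightarrow> tangle \<Rightarrow> (nat \<Rightarrow> 'a) \<Rightarrow> 'a" where
  "longitudinal G x T C = x [^]\<^bsub>G\<^esub> (- writhe T) \<otimes>\<^bsub>G\<^esub>
     foldr (\<lambda>i g. C (over_arc T i) [^]\<^bsub>G\<^esub> crossing_sign T i \<otimes>\<^bsub>G\<^esub> g)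
       [1..<Suc (last_arc T)] \<one>\<^bsub>G\<^esub>"


section \<open>Liftings exist uniquely along coverings\<close>

lemma coloringsD:
  assumes "C \<in> colorings X e T"
  shows "C \<in> extensional {0..last_arc T}" "C 0 = e"
    and "i \<le> last_arc T \<Longrightarrow> C i \<in> carrier X"
    and "Suc i \<le> last_arc T \<Longrightarrow>
      C (Suc i) = qop_sgn X (crossing_sign T (Suc i)) (C i) (C (over_arc T (Suc i)))"
proof -
  have C: "C \<in> {0..last_arc T} \<rightarrow>\<^sub>E carrier X" and "C 0 = e" and
    step: "\<And>i. i \<in> {1..last_arc T} \<Longrightarrow>
      C i = qop_sgn X (crossing_sign T i) (C (i - 1)) (C (over_arc T i))"
    using assms unfolding colorings_def by blast+
  show "C \<in> extensional {0..last_arc T}"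
    using C by (simp add: PiE_def)
  show "C 0 = e" by fact
  show "C i \<in> carrier X" if "i \<le> last_arc T"
    using PiE_mem[OF C, of i] that by simp
  show "C (Suc i) = qop_sgn X (crossing_sign T (Suc i)) (C i) (C (over_arc T (Suc i)))"
    if "Suc i \<le> last_arc T"
    by (rule step[of "Suc i", unfolded diff_Suc_1]) (use that in simp)
qed

lemma coloringsI:
  assumes "C \<in> extensional {0..last_arc T}" "C 0 = e"
    and "\<And>i. i \<le> last_arc T \<Longrightarrow> C i \<in> carrier X"
    and step: "\<And>i. Suc i \<le> last_arc T \<Longrightarrow>
      C (Suc i) = qop_sgn X (crossing_sign T (Suc i)) (C i) (C (over_arc T (Suc i)))"
  shows "C \<in> colorings X e T"
proof -
  have "C i = qop_sgn X (crossing_sign T i) (C (i - 1)) (C (over_arc T i))"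
    if i: "i \<in> {1..last_arc T}" for i
  proof -
    obtain j where j: "i = Suc j" using i by (cases i) auto
    show ?thesis
      unfolding j diff_Suc_1 by (rule step) (use i j in simp)
  qed
  moreover have "C \<in> {0..last_arc T} \<rightarrow>\<^sub>E carrier X"
    using assms(1,3) by (simp add: PiE_def Pi_def)
  ultimately show ?thesis
    using assms(2) unfolding colorings_def by blast
qed

lemma qop_sgn_one [simp]: "qop_sgn X 1 y a = y \<triangleleft>\<^bsub>X\<^esub> a"
  by (simp add: qop_sgn_def)

lemma quandleI:
  assumes "\<And>a. a \<in> carrier X \<Longrightarrow> a \<triangleleft>\<^bsub>X\<^esub> a = a"
    and bij: "\<And>a. a \<in> carrier X \<Longrightarrow> bij_betw (\<lambda>y. y \<triangleleft>\<^bsub>X\<^esub> a) (carrier X) (carrier X)"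
    and "\<And>a y z. a \<in> carrier X \<Longrightarrow> y \<in> carrier X \<Longrightarrow> z \<in> carrier X \<Longrightarrow>
      (y \<triangleleft>\<^bsub>X\<^esub> z) \<triangleleft>\<^bsub>X\<^esub> a = (y \<triangleleft>\<^bsub>X\<^esub> a) \<triangleleft>\<^bsub>X\<^esub> (z \<triangleleft>\<^bsub>X\<^esub> a)"
  shows "quandle X"
proof -
  have "y \<triangleleft>\<^bsub>X\<^esub> a \<in> carrier X" if "a \<in> carrier X" "y \<in> carrier X" for a y
    using bij_betwE[OF bij[OF that(1)]] that(2) by blast
  with assms show ?thesis
    unfolding quandle_def quandle_aut_def quandle_hom_def by blast
qed

context
  fixes X :: "('a, 'c) magma_scheme"
  assumes X: "quandle X"
begin

lemma qop_bij: "a \<in> carrier X \<Longrightarrow> bij_betw (\<lambda>y. y \<triangleleft>\<^bsub>X\<^esub> a) (carrier X) (carrier X)"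
  using X by (auto simp: quandle_def quandle_aut_def)

lemma qop_bar_eq_iff:
  assumes "a \<in> carrier X" "y \<in> carrier X" "z \<in> carrier X"
  shows "qop_bar X y a = z \<longleftrightarrow> y = z \<triangleleft>\<^bsub>X\<^esub> a"
  using bij_betw_inv_into_left[OF qop_bij[OF assms(1)] assms(3)]
    bij_betw_inv_into_right[OF qop_bij[OF assms(1)] assms(2)]
  unfolding qop_bar_def by auto

lemma qop_sgn_closed:
  assumes "a \<in> carrier X" "y \<in> carrier X"
  shows "qop_sgn X s y a \<in> carrier X"
  using bij_betwE[OF qop_bij[OF assms(1)]] bij_betwE[OF bij_betw_inv_into[OF qop_bij[OF assms(1)]]]
    assms by (auto simp: qop_sgn_def qop_bar_def)

lemma qop_bar_right_inv:
  assumes "a \<in> carrier X" "y \<in> carrier X"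
  shows "qop_bar X y a \<triangleleft>\<^bsub>X\<^esub> a = y"
  using bij_betw_inv_into_right[OF qop_bij[OF assms(1)] assms(2)]
  unfolding qop_bar_def .

end

context
  fixes X :: "('a, 'c) magma_scheme" and Y :: "('b, 'd) magma_scheme" and p
  assumes cov: "quandle_covering X Y p"
begin

lemma cov_quandles: "quandle X" "quandle Y"
  using cov unfolding quandle_covering_def by blast+

lemma cov_closed: "y \<in> carrier X \<Longrightarrow> p y \<in> carrier Y"
  using cov unfolding quandle_covering_def by blast

lemma cov_hom:
  assumes "y \<in> carrier X" "z \<in> carrier X"
  shows "p (y \<triangleleft>\<^bsub>X\<^esub> z) = p y \<triangleleft>\<^bsub>Y\<^esub> p z"
proof -
  have "p \<in> quandle_hom X Y"
    using cov unfolding quandle_covering_def by blast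
  then show ?thesis
    using assms by (simp add: quandle_hom_def)
qed

lemma cov_qop_sgn:
  assumes "y \<in> carrier X" "a \<in> carrier X"
  shows "p (qop_sgn X s y a) = qop_sgn Y s (p y) (p a)"
proof -
  have hom: "p (z \<triangleleft>\<^bsub>X\<^esub> a) = p z \<triangleleft>\<^bsub>Y\<^esub> p a" if "z \<in> carrier X" for z
    using that assms(2) by (rule cov_hom)
  define z where "z = qop_bar X y a"
  have z: "z \<in> carrier X" "z \<triangleleft>\<^bsub>X\<^esub> a = y"
    using qop_bar_right_inv[OF cov_quandles(1) assms(2,1)]
      qop_sgn_closed[OF cov_quandles(1) assms(2,1), of 0]
    by (auto simp: z_def qop_sgn_def)
  have "qop_bar Y (p y) (p a) = p z"
    using qop_bar_eq_iff[OF cov_quandles(2) cov_closed[OF assms(2)] cov_closed[OF assms(1)]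
        cov_closed[OF z(1)]] hom[OF z(1)] z(2) by simp
  then show ?thesis
    using hom[OF assms(1)] by (simp add: qop_sgn_def z_def)
qed

lemma cov_fibre:
  assumes "y \<in> carrier X" "a \<in> carrier X" "b \<in> carrier X" "p a = p b"
  shows "qop_sgn X s y a = qop_sgn X s y b"
proof -
  have eq: "z \<triangleleft>\<^bsub>X\<^esub> a = z \<triangleleft>\<^bsub>X\<^esub> b" if "z \<in> carrier X" for z
    using cov assms that unfolding quandle_covering_def by blast
  then have "qop_bar X y a = qop_bar X y b"
    using qop_bar_eq_iff[OF cov_quandles(1) assms(2,1), of "qop_bar X y b"]
      qop_bar_right_inv[OF cov_quandles(1) assms(3,1)]
      qop_sgn_closed[OF cov_quandles(1) assms(3,1), of 0] by (simp add: qop_sgn_def)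
  with eq[OF assms(1)] show ?thesis
    by (simp add: qop_sgn_def)
qed

lemma lifting_bij:
  assumes T: "wirtinger_code T" and e: "e \<in> carrier X"
  shows "bij_betw (compose {0..last_arc T} p) (colorings X e T) (colorings Y (p e) T)"
proof -
  let ?A = "{0..last_arc T}"
  let ?k = "over_arc T" and ?s = "crossing_sign T"
  have k: "?k i \<in> ?A" if "i \<in> {1..last_arc T}" for i
    using T that by (auto simp: wirtinger_code_def)
  show ?thesis
  proof (rule bij_betw_imageI)
    show "inj_on (compose ?A p) (colorings X e T)"
    proof (rule inj_onI)
      fix D E assume D: "D \<in> colorings X e T" and E: "E \<in> colorings X e T"
        and eq: "compose ?A p D = compose ?A p E"
      have pD: "p (D i) = p (E i)" if "i \<in> ?A" for i
        using fun_cong[OF eq, of i] that by (simp add: compose_eq)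
      have mem: "D i \<in> carrier X" "E i \<in> carrier X" if "i \<in> ?A" for i
        using D E that by (auto intro: coloringsD)
      have "i \<le> last_arc T \<longrightarrow> D i = E i" for i
      proof (induction i)
        case 0
        show ?case using coloringsD(2)[OF D] coloringsD(2)[OF E] by simp
      next
        case (Suc i)
        show ?case
        proof
          assume i: "Suc i \<le> last_arc T"
          then have ki: "?k (Suc i) \<in> ?A" using k by simp
          have "D (Suc i) = qop_sgn X (?s (Suc i)) (D i) (D (?k (Suc i)))"
            by (rule coloringsD(4)[OF D i])
          also have "\<dots> = qop_sgn X (?s (Suc i)) (D i) (E (?k (Suc i)))"
            using i by (intro cov_fibre mem ki pD) auto
          also have "\<dots> = qop_sgn X (?s (Suc i)) (E i) (E (?k (Suc i)))"
            using Suc i by simp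
          also have "\<dots> = E (Suc i)"
            by (rule coloringsD(4)[OF E i, symmetric])
          finally show "D (Suc i) = E (Suc i)" .
        qed
      qed
      moreover have "D \<in> extensional ?A" "E \<in> extensional ?A"
        by (rule coloringsD(1)[OF D], rule coloringsD(1)[OF E])
      ultimately show "D = E"
        by (auto intro: extensionalityI)
    qed
    show "compose ?A p ` colorings X e T = colorings Y (p e) T"
    proof (intro subset_antisym subsetI)
      fix C assume "C \<in> compose ?A p ` colorings X e T"
      then obtain D where D: "D \<in> colorings X e T" and C: "C = compose ?A p D"
        by blast
      have mem: "D i \<in> carrier X" if "i \<in> ?A" for i
        using coloringsD(3)[OF D] that by simp
      have C': "C i = p (D i)" if "i \<in> ?A" for i
        using that by (simp add: C compose_eq)
      show "C \<in> colorings Y (p e) T"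
      proof (rule coloringsI)
        show "C \<in> extensional ?A" by (simp add: C compose_def)
        show "C 0 = p e" using C'[of 0] coloringsD(2)[OF D] by simp
        show "C i \<in> carrier Y" if "i \<le> last_arc T" for i
          using C'[of i] cov_closed[OF mem[of i]] that by simp
      next
        fix i assume i: "Suc i \<le> last_arc T"
        then have ki: "?k (Suc i) \<in> ?A" using k by simp
        have "C (Suc i) = p (qop_sgn X (?s (Suc i)) (D i) (D (?k (Suc i))))"
          using C'[of "Suc i"] coloringsD(4)[OF D i] i by simp
        also have "\<dots> = qop_sgn Y (?s (Suc i)) (p (D i)) (p (D (?k (Suc i))))"
          using i by (intro cov_qop_sgn mem ki) simp
        finally show "C (Suc i) = qop_sgn Y (?s (Suc i)) (C i) (C (?k (Suc i)))"
          using C'[of i] C'[OF ki] i by simp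
      qed
    next
      fix C assume C: "C \<in> colorings Y (p e) T"
      have memC: "C i \<in> carrier Y" if "i \<in> ?A" for i
        using coloringsD(3)[OF C] that by simp
      define l where "l = (\<lambda>b. inv_into (carrier X) p b)"
      have l: "l b \<in> carrier X" "p (l b) = b" if "b \<in> carrier Y" for b
      proof -
        have b: "b \<in> p ` carrier X"
          using cov that unfolding quandle_covering_def by blast
        show "l b \<in> carrier X" "p (l b) = b"
          unfolding l_def by (rule inv_into_into[OF b], rule f_inv_into_f[OF b])
      qed
      define D0 where "D0 = rec_nat e (\<lambda>i d. qop_sgn X (?s (Suc i)) d (l (C (?k (Suc i)))))"
      have D0: "i \<le> last_arc T \<longrightarrow> D0 i \<in> carrier X \<and> p (D0 i) = C i" for i
      proof (induction i)
        case 0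
        show ?case using e coloringsD(2)[OF C] by (simp add: D0_def)
      next
        case (Suc i)
        show ?case
        proof
          assume i: "Suc i \<le> last_arc T"
          then have "C (?k (Suc i)) \<in> carrier Y" using k memC by simp
          note l' = l[OF this]
          have D: "D0 (Suc i) = qop_sgn X (?s (Suc i)) (D0 i) (l (C (?k (Suc i))))"
            by (simp add: D0_def)
          have IH: "D0 i \<in> carrier X" "p (D0 i) = C i" using Suc i by auto
          have "C (Suc i) = qop_sgn Y (?s (Suc i)) (C i) (C (?k (Suc i)))"
            by (rule coloringsD(4)[OF C i])
          then show "D0 (Suc i) \<in> carrier X \<and> p (D0 (Suc i)) = C (Suc i)"
            using cov_qop_sgn[OF IH(1) l'(1)] qop_sgn_closed[OF cov_quandles(1) l'(1) IH(1)]
            by (simp add: D IH(2) l'(2))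
        qed
      qed
      define D where "D = restrict D0 ?A"
      have "D \<in> colorings X e T"
      proof (rule coloringsI)
        show "D \<in> extensional ?A" "D 0 = e"
          by (simp_all add: D_def D0_def)
        show "D i \<in> carrier X" if "i \<le> last_arc T" for i
          using D0[of i] that by (simp add: D_def)
      next
        fix i assume i: "Suc i \<le> last_arc T"
        then have ki: "?k (Suc i) \<le> last_arc T" using k[of "Suc i"] by simp
        have "D (Suc i) = qop_sgn X (?s (Suc i)) (D i) (l (C (?k (Suc i))))"
          using i by (simp add: D_def D0_def)
        also have "\<dots> = qop_sgn X (?s (Suc i)) (D i) (D (?k (Suc i)))"
          using i ki D0 l memC by (intro cov_fibre) (auto simp: D_def)
        finally show "D (Suc i) = qop_sgn X (?s (Suc i)) (D i) (D (?k (Suc i)))" .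
      qed
      moreover have "compose ?A p D = C"
      proof (rule extensionalityI[of _ ?A])
        show "C \<in> extensional ?A" by (rule coloringsD(1)[OF C])
        show "compose ?A p D i = C i" if "i \<in> ?A" for i
          using D0[of i] that by (simp add: compose_eq D_def)
      qed (simp add: compose_def)
      ultimately show "C \<in> compose ?A p ` colorings X e T" by blast
    qed
  qed
qed

lemma lifting_eqI:
  assumes "wirtinger_code T" "D \<in> colorings X e T" "compose {0..last_arc T} p D = C"
  shows "lifting X p e T C = D"
proof -
  have "e \<in> carrier X"
    using coloringsD(2)[OF assms(2)] coloringsD(3)[OF assms(2), of 0] by simp
  from lifting_bij[OF assms(1) this] have "inj_on (compose {0..last_arc T} p) (colorings X e T)"
    by (simp add: bij_betw_def)
  with assms(2,3) show ?thesis
    unfolding lifting_def by (intro the_equality) (auto dest: inj_onD)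
qed

end


section \<open>The covering of the conjugation quandle\<close>

context
  fixes G (structure) and x
  assumes grp: "group G" and x: "x \<in> carrier G"
begin

interpretation group G by (rule grp)
interpretation D: normal "derived G (carrier G)" G by (rule derived_self_is_normal)

lemma cancel:
  assumes "h \<in> carrier G" "u \<in> carrier G"
  shows "h \<otimes> (inv h \<otimes> u) = u" "inv h \<otimes> (h \<otimes> u) = u"
  using assms by (simp_all flip: m_assoc)

lemma conj_quandle_is_quandle: "quandle (conj_quandle G x)"
proof -
  have sub: "conj_class G x \<subseteq> carrier G"
    using x by (auto simp: conj_class_def)
  have cl: "inv a \<otimes> y \<otimes> a \<in> conj_class G x" if ay: "a \<in> carrier G" "y \<in> conj_class G x" for a y
  proof -
    obtain g where "g \<in> carrier G" "y = inv g \<otimes> x \<otimes> g"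
      using ay(2) by (auto simp: conj_class_def)
    then have "inv a \<otimes> y \<otimes> a = inv (g \<otimes> a) \<otimes> x \<otimes> (g \<otimes> a)" "g \<otimes> a \<in> carrier G"
      using ay x by (auto simp: inv_mult_group m_assoc)
    then show ?thesis unfolding conj_class_def by blast
  qed
  have bij: "bij_betw (\<lambda>y. inv a \<otimes> y \<otimes> a) (conj_class G x) (conj_class G x)"
    if a: "a \<in> carrier G" for a
  proof (rule bij_betw_byWitness[where f' = "\<lambda>y. a \<otimes> y \<otimes> inv a"])
    have "a \<otimes> y \<otimes> inv a \<in> conj_class G x" if "y \<in> conj_class G x" for y
      using cl[of "inv a" y] a that by simp
    then show "(\<lambda>y. a \<otimes> y \<otimes> inv a) ` conj_class G x \<subseteq> conj_class G x" by auto
    show "\<forall>y\<in>conj_class G x. a \<otimes> (inv a \<otimes> y \<otimes> a) \<otimes> inv a = y"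
         "\<forall>y\<in>conj_class G x. inv a \<otimes> (a \<otimes> y \<otimes> inv a) \<otimes> a = y"
      using a sub by (auto simp: m_assoc subset_iff cancel)
  qed (use cl a in auto)
  have hom: "inv a \<otimes> (inv z \<otimes> y \<otimes> z) \<otimes> a =
      inv (inv a \<otimes> z \<otimes> a) \<otimes> (inv a \<otimes> y \<otimes> a) \<otimes> (inv a \<otimes> z \<otimes> a)"
    if "a \<in> carrier G" "y \<in> carrier G" "z \<in> carrier G" for a y z
    using that by (simp add: inv_mult_group m_assoc cancel)
  have idem: "inv a \<otimes> a \<otimes> a = a" if "a \<in> carrier G" for a
    using that by simp
  have sub': "a \<in> carrier G" if "a \<in> conj_class G x" for a
    using sub that by blast
  show ?thesis
    by (rule quandleI; unfold conj_quandle_def; simp)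
      (rule idem bij hom; (assumption | erule sub'))+
qed

abbreviation (input) "gq \<equiv> GAlex (commutator_subgroup G) (conj_aut G x)"

lemma gq_carrier: "carrier gq = derived G (carrier G)"
  by (simp add: GAlex_def commutator_subgroup_def)

lemma derived_mem: "g \<in> derived G (carrier G) \<Longrightarrow> g \<in> carrier G"
  using D.subset by auto

lemma gq_qop:
  assumes "g \<in> derived G (carrier G)" "h \<in> derived G (carrier G)"
  shows "g \<triangleleft>\<^bsub>gq\<^esub> h = inv x \<otimes> g \<otimes> inv h \<otimes> x \<otimes> h"
  using assms x
  by (simp add: GAlex_def commutator_subgroup_def conj_aut_def m_inv_consistent[OF D.subgroup_axioms] m_assoc derived_mem)

lemma gq_is_quandle: "quandle gq"
proof -
  let ?D = "derived G (carrier G)"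
  have cl: "g \<triangleleft>\<^bsub>gq\<^esub> h \<in> ?D" if "g \<in> ?D" "h \<in> ?D" for g h
  proof -
    have "inv x \<otimes> (g \<otimes> inv h) \<otimes> x \<in> ?D"
      using that x by (intro D.inv_op_closed1) auto
    then have "inv x \<otimes> (g \<otimes> inv h) \<otimes> x \<otimes> h \<in> ?D"
      using that by auto
    then show ?thesis
      using that x by (simp add: gq_qop m_assoc cancel derived_mem)
  qed
  have idem: "g \<triangleleft>\<^bsub>gq\<^esub> g = g" if "g \<in> ?D" for g
    using that x by (simp add: gq_qop m_assoc cancel derived_mem)
  have hom: "(y \<triangleleft>\<^bsub>gq\<^esub> z) \<triangleleft>\<^bsub>gq\<^esub> a = (y \<triangleleft>\<^bsub>gq\<^esub> a) \<triangleleft>\<^bsub>gq\<^esub> (z \<triangleleft>\<^bsub>gq\<^esub> a)"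
    if "a \<in> ?D" "y \<in> ?D" "z \<in> ?D" for a y z
    apply (subst gq_qop[OF cl[OF that(2,3)] that(1)])
    apply (subst gq_qop[OF cl[OF that(2,1)] cl[OF that(3,1)]])
    unfolding gq_qop[OF that(2,3)] gq_qop[OF that(2,1)] gq_qop[OF that(3,1)]
    using that x by (simp add: m_assoc cancel derived_mem inv_mult_group)
  have bij: "bij_betw (\<lambda>y. y \<triangleleft>\<^bsub>gq\<^esub> a) ?D ?D" if a: "a \<in> ?D" for a
  proof (rule bij_betw_byWitness[where f' = "\<lambda>y. x \<otimes> y \<otimes> inv a \<otimes> inv x \<otimes> a"])
    have cl': "x \<otimes> y \<otimes> inv a \<otimes> inv x \<otimes> a \<in> ?D" if "y \<in> ?D" for y
    proof -
      have "x \<otimes> (y \<otimes> inv a) \<otimes> inv x \<in> ?D"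
        using that a x by (intro D.inv_op_closed2) auto
      then have "x \<otimes> (y \<otimes> inv a) \<otimes> inv x \<otimes> a \<in> ?D"
        using a by auto
      then show ?thesis
        using that a x by (simp add: m_assoc cancel derived_mem)
    qed
    then show "(\<lambda>y. x \<otimes> y \<otimes> inv a \<otimes> inv x \<otimes> a) ` ?D \<subseteq> ?D" by auto
    show "(\<lambda>y. y \<triangleleft>\<^bsub>gq\<^esub> a) ` ?D \<subseteq> ?D" using cl a by auto
    show "\<forall>y\<in>?D. x \<otimes> (y \<triangleleft>\<^bsub>gq\<^esub> a) \<otimes> inv a \<otimes> inv x \<otimes> a = y"
      using a x by (simp add: gq_qop m_assoc cancel derived_mem)
    show "\<forall>y\<in>?D. (x \<otimes> y \<otimes> inv a \<otimes> inv x \<otimes> a) \<triangleleft>\<^bsub>gq\<^esub> a = y"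
      using a x by (intro ballI, subst gq_qop[OF cl' a])
        (simp_all add: m_assoc cancel derived_mem)
  qed
  show ?thesis
    by (rule quandleI; unfold gq_carrier) (fact idem bij hom)+
qed

lemma galex_proj_covering:
  assumes gen: "generate G (conj_class G x) = carrier G"
  shows "quandle_covering gq (conj_quandle G x) (galex_proj G x)"
proof -
  let ?D = "derived G (carrier G)"
  have qcl: "g \<triangleleft>\<^bsub>gq\<^esub> h \<in> ?D" if "g \<in> ?D" "h \<in> ?D" for g h
    using qop_sgn_closed[OF gq_is_quandle, of h g 1] that by (simp add: gq_carrier)
  have comm: "x \<otimes> h \<otimes> inv x \<otimes> inv h \<in> ?D" if "x \<in> carrier G" "h \<in> carrier G" for x h
    using that by (auto simp: derived_def intro!: generate.incl)
  have dec: "\<exists>k::int. \<exists>g\<in>?D. a = x [^] k \<otimes> g" if "a \<in> generate G (conj_class G x)" for a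
    using that
  proof (induction rule: generate.induct)
    case one
    show ?case
      by (intro exI[of _ 0] bexI[of _ \<one>]) auto
  next
    case (incl a)
    then obtain h where h: "h \<in> carrier G" "a = inv h \<otimes> x \<otimes> h"
      by (auto simp: conj_class_def)
    have "a = x [^] (1::int) \<otimes> (inv x \<otimes> inv h \<otimes> inv (inv x) \<otimes> inv (inv h))"
      using h x by (simp add: m_assoc cancel int_pow_1)
    with comm[of "inv x" "inv h"] h x show ?case by blast
  next
    case (inv a)
    then obtain h where h: "h \<in> carrier G" "a = inv h \<otimes> x \<otimes> h"
      by (auto simp: conj_class_def)
    have "inv a = x [^] (-1::int) \<otimes> (x \<otimes> inv h \<otimes> inv x \<otimes> inv (inv h))"
      using h x by (simp add: m_assoc cancel int_pow_neg int_pow_1 inv_mult_group)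
    with comm[of x "inv h"] h x show ?case by blast
  next
    case (eng a b)
    then obtain k l :: int and g h where gh: "g \<in> ?D" "h \<in> ?D"
      "a = x [^] k \<otimes> g" "b = x [^] l \<otimes> h" by blast
    have "inv (x [^] l) \<otimes> g \<otimes> x [^] l \<in> ?D"
      using gh x by (intro D.inv_op_closed1) auto
    then have mem: "inv (x [^] l) \<otimes> g \<otimes> x [^] l \<otimes> h \<in> ?D"
      using gh by auto
    have "a \<otimes> b = x [^] (k + l) \<otimes> (inv (x [^] l) \<otimes> g \<otimes> x [^] l \<otimes> h)"
      using gh x by (simp add: m_assoc cancel int_pow_mult derived_mem)
    with mem show ?case by blast
  qed
  have surj: "galex_proj G x ` ?D = conj_class G x"
  proof (intro subset_antisym subsetI)
    fix y assume "y \<in> conj_class G x"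
    then obtain a where a: "a \<in> carrier G" "y = inv a \<otimes> x \<otimes> a"
      by (auto simp: conj_class_def)
    with dec gen obtain k :: int and g where g: "g \<in> ?D" "a = x [^] k \<otimes> g" by blast
    have "x [^] k \<otimes> x = x [^] (1 + k)"
      using x int_pow_mult[of x k 1] by (simp add: int_pow_1 add.commute)
    then have c: "x \<otimes> x [^] k = x [^] k \<otimes> x"
      using x int_pow_mult[of x 1 k] by (simp add: int_pow_1)
    have "x \<otimes> (x [^] k \<otimes> g) = x [^] k \<otimes> (x \<otimes> g)"
      using c g x by (metis m_assoc int_pow_closed derived_mem)
    then have "y = galex_proj G x g"
      using a g x by (simp add: galex_proj_def inv_mult_group m_assoc cancel derived_mem)
    with g show "y \<in> galex_proj G x ` ?D" by blast
  qed (auto simp: galex_proj_def conj_class_def derived_mem)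
  have hom: "galex_proj G x (y \<triangleleft>\<^bsub>gq\<^esub> z) =
      galex_proj G x y \<triangleleft>\<^bsub>conj_quandle G x\<^esub> galex_proj G x z" if "y \<in> ?D" "z \<in> ?D" for y z
  proof -
    have "galex_proj G x (y \<triangleleft>\<^bsub>gq\<^esub> z) =
        inv (y \<triangleleft>\<^bsub>gq\<^esub> z) \<otimes> x \<otimes> (y \<triangleleft>\<^bsub>gq\<^esub> z)"
      using qcl[OF that] by (simp add: galex_proj_def)
    also have "\<dots> = galex_proj G x y \<triangleleft>\<^bsub>conj_quandle G x\<^esub> galex_proj G x z"
      unfolding gq_qop[OF that] using that x
      by (simp add: galex_proj_def conj_quandle_def m_assoc cancel derived_mem inv_mult_group)
    finally show ?thesis .
  qed
  have fib: "a \<triangleleft>\<^bsub>gq\<^esub> y = a \<triangleleft>\<^bsub>gq\<^esub> z"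
    if "a \<in> ?D" "y \<in> ?D" "z \<in> ?D" "galex_proj G x y = galex_proj G x z" for a y z
  proof -
    have "a \<triangleleft>\<^bsub>gq\<^esub> y = inv x \<otimes> a \<otimes> galex_proj G x y" if "y \<in> ?D" for y
      using \<open>a \<in> ?D\<close> that x by (simp add: galex_proj_def gq_qop m_assoc cancel derived_mem)
    with that show ?thesis by simp
  qed
  have carr: "carrier (conj_quandle G x) = conj_class G x"
    by (simp add: conj_quandle_def)
  have maps: "galex_proj G x \<in> ?D \<rightarrow> conj_class G x"
    using surj by blast
  show ?thesis
    unfolding quandle_covering_def quandle_hom_def gq_carrier carr mem_Collect_eq
    by (intro conjI ballI impI gq_is_quandle conj_quandle_is_quandle surj hom maps; (rule fib)?)
qed

end

end

theory Submission
  imports Defs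
begin

text \<open>
  In \<open>GAlex(G', f\<^sub>x)\<close> one has \<open>g *\<^sup>s h = x\<^sup>-\<^sup>s g (h\<^sup>-\<^sup>1 x h)\<^sup>s\<close> for \<open>s = \<plusminus>1\<close>.  Hence passing an
  undercrossing multiplies the lifted color by \<open>x\<^sup>-\<^sup>s\<close> on the left and by the \<open>s\<close>-th power of the
  color in \<open>x\<^sup>G\<close> of the overcrossing arc on the right; starting from the color \<open>1\<close>, the factors
  collected along the tangle are those of the longitudinal mapping.
\<close>

context
  fixes G (structure) and x
  assumes grp: "group G" and x: "x \<in> carrier G"
begin

interpretation group G by (rule grp)

text \<open>The color \<open>h\<close> acts only through its projection \<open>c\<close>: right
  translation by \<open>h\<close> is \<open>y \<mapsto> inv x \<otimes> y \<otimes> c\<close>.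
  Solving this for \<open>y\<close> settles the exponent -1.\<close>

lemma GAlex_qop_sgn:
  assumes g: "g \<in> derived G (carrier G)" and h: "h \<in> derived G (carrier G)"
    and s: "s \<in> {1, -1}"
  shows "qop_sgn (GAlex (commutator_subgroup G) (conj_aut G x)) s g h =
    x [^] (- s) \<otimes> g \<otimes> galex_proj G x h [^] s"
proof -
  let ?X = "GAlex (commutator_subgroup G) (conj_aut G x)"
  note quandle = gq_is_quandle[OF grp x] and carrier = gq_carrier[OF grp x]
    and in_G = derived_mem[OF grp x]
  define c where "c = galex_proj G x h"
  have c: "c \<in> carrier G" "c = inv h \<otimes> x \<otimes> h"
    using h x in_G by (simp_all add: c_def galex_proj_def)
  have op: "y \<triangleleft>\<^bsub>?X\<^esub> h = inv x \<otimes> y \<otimes> c" if "y \<in> derived G (carrier G)" for y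
    using that h x in_G by (simp add: gq_qop[OF grp x] c m_assoc)
  define z where "z = qop_bar ?X g h"
  \<comment> \<open>Exponent 0 serves for closure because \<open>qop_sgn\<close> is the inverse
    operation at every exponent other than 1.\<close>
  have z: "z \<in> derived G (carrier G)" "g = z \<triangleleft>\<^bsub>?X\<^esub> h"
    using qop_sgn_closed[OF quandle, of h g 0] qop_bar_right_inv[OF quandle, of h g] g h
    by (simp_all add: z_def qop_sgn_def carrier)
  have "z = x \<otimes> g \<otimes> inv c"
    using z in_G c(1) x by (simp add: op m_assoc cancel[OF grp x])
  with s op[OF g] show ?thesis
    using x c(1) by (auto simp: qop_sgn_def z_def int_pow_neg int_pow_1 simp flip: c_def)
qed

text \<open>Induction along the arcs. A new crossing contributes the innermost factor of the
  \<open>foldr\<close>, which changes its start value; the arbitrary right factor \<open>a\<close>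
  keeps the induction hypothesis applicable.\<close>

lemma GAlex_coloring_eq:
  assumes T: "wirtinger_code T"
    and D: "D \<in> colorings (GAlex (commutator_subgroup G) (conj_aut G x)) \<one> T"
    and C: "\<And>i. i \<le> last_arc T \<Longrightarrow> C i = galex_proj G x (D i)"
    and "i \<le> last_arc T" and "a \<in> carrier G"
  shows "D i \<otimes> a = x [^] (- (\<Sum>j = 1..i. crossing_sign T j)) \<otimes>
    foldr (\<lambda>j g. C (over_arc T j) [^] crossing_sign T j \<otimes> g) [1..<Suc i] a"
  using assms(4,5)
proof (induction i arbitrary: a)
  case 0
  then show ?case
    using coloringsD(2)[OF D] by simp
next
  case (Suc i)
  let ?k = "over_arc T (Suc i)" and ?s = "crossing_sign T (Suc i)"
  let ?w = "\<Sum>j = 1..i. crossing_sign T j"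
  let ?F = "foldr (\<lambda>j g. C (over_arc T j) [^] crossing_sign T j \<otimes> g)"
  have D_mem: "D j \<in> derived G (carrier G)" if "j \<le> last_arc T" for j
    using coloringsD(3)[OF D that] by (simp add: gq_carrier[OF grp x])
  have C_mem: "C j \<in> carrier G" if "j \<le> last_arc T" for j
    using D_mem[OF that] x that by (simp add: C galex_proj_def derived_mem[OF grp x])
  have k: "over_arc T j \<le> last_arc T" "crossing_sign T j \<in> {1, -1}" if "j \<in> {1..last_arc T}" for j
    using T that by (auto simp: wirtinger_code_def)
  have F_mem: "?F js b \<in> carrier G" if "set js \<subseteq> {1..last_arc T}" "b \<in> carrier G" for js b
    using that by (induction js) (auto intro!: C_mem k int_pow_closed)
  have ki: "?k \<le> last_arc T" "?s \<in> {1, -1}"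
    using k[of "Suc i"] Suc.prems by auto
  \<comment> \<open>The factor of the last crossing is absorbed into the start value, so that the
    fold up to \<open>Suc i\<close> from \<open>a\<close> is the fold up to \<open>i\<close> from
    \<open>b\<close>.\<close>
  define b where "b = C ?k [^] ?s \<otimes> a"
  have b: "b \<in> carrier G"
    using C_mem[OF ki(1)] Suc.prems by (simp add: b_def)
  have Fb: "?F [1..<Suc i] b \<in> carrier G"
    using Suc.prems b by (intro F_mem) auto
  have Di: "D i \<in> carrier G"
    using D_mem[of i] Suc.prems derived_mem[OF grp x] by simp
  have "D (Suc i) = x [^] (- ?s) \<otimes> D i \<otimes> C ?k [^] ?s"
    using coloringsD(4)[OF D Suc.prems(1)] GAlex_qop_sgn[OF D_mem D_mem[OF ki(1)] ki(2), of i]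
      Suc.prems ki(1) by (simp add: C)
  then have "D (Suc i) \<otimes> a = x [^] (- ?s) \<otimes> (D i \<otimes> b)"
    using Di x C_mem[OF ki(1)] Suc.prems by (simp add: b_def m_assoc)
  also have "\<dots> = x [^] (- ?s) \<otimes> (x [^] (- ?w) \<otimes> ?F [1..<Suc i] b)"
    using Suc.IH[OF _ b] Suc.prems by simp
  \<comment> \<open>The powers of \<open>x\<close> meet on the far left, so they add up without
    moving past any color.\<close>
  also have "\<dots> = x [^] (- ?s + - ?w) \<otimes> ?F [1..<Suc i] b"
    using x Fb by (simp only: int_pow_mult m_assoc int_pow_closed)
  also have "\<dots> = x [^] (- (\<Sum>j = 1..Suc i. crossing_sign T j)) \<otimes> ?F [1..<Suc (Suc i)] a"
    by (simp add: b_def algebra_simps)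
  finally show ?case .
qed

end

theorem theoremB4:
  fixes G (structure) and x :: 'a and T :: tangle and C :: "nat \<Rightarrow> 'a"
  assumes "group G" and "x \<in> carrier G"
    and "generate G (conj_class G x) = carrier G"
    and "wirtinger_code T"
    and "C \<in> colorings (conj_quandle G x) x T"
  shows "lifting (GAlex (commutator_subgroup G) (conj_aut G x)) (galex_proj G x) \<one> T C (last_arc T)
           = longitudinal G x T C"
proof -
  interpret group G by (rule assms(1))
  interpret D: normal "derived G (carrier G)" G by (rule derived_self_is_normal)
  let ?X = "GAlex (commutator_subgroup G) (conj_aut G x)"
  note carrier = gq_carrier[OF assms(1,2)]
  \<comment> \<open>That the conjugacy class generates \<open>G\<close> is what makes the projection
    from \<open>G'\<close> onto it surjective.\<close>
  note covering = galex_proj_covering[OF assms(1-3)]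
  \<comment> \<open>As \<open>\<one>\<close> lies over \<open>x\<close>, every coloring based at
    \<open>x\<close> lifts to one based at \<open>\<one>\<close>.\<close>
  have "galex_proj G x \<one> = x" "\<one> \<in> carrier ?X"
    using assms(2) by (simp_all add: galex_proj_def carrier)
  with lifting_bij[OF covering assms(4), of \<one>] assms(5)
  have "C \<in> compose {0..last_arc T} (galex_proj G x) ` colorings ?X \<one> T"
    by (simp add: bij_betw_def)
  then obtain D where D: "D \<in> colorings ?X \<one> T"
    and C: "compose {0..last_arc T} (galex_proj G x) D = C"
    by blast
  have "C i = galex_proj G x (D i)" if "i \<le> last_arc T" for i
    using that by (simp add: compose_eq flip: C)
  from GAlex_coloring_eq[OF assms(1,2,4) D this order_refl one_closed]
  have "D (last_arc T) \<otimes> \<one> = longitudinal G x T C"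
    by (simp add: longitudinal_def writhe_def)
  moreover have "D (last_arc T) \<in> carrier G"
    using coloringsD(3)[OF D, of "last_arc T"] derived_mem[OF assms(1,2)] by (simp add: carrier)
  \<comment> \<open>Uniqueness of liftings identifies \<open>D\<close> with the described
    lifting.\<close>
  ultimately show ?thesis
    using lifting_eqI[OF covering assms(4) D C] by simp
qed

end
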